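(* Let $K$ be a knot. Then $s^{\mathbb{F}_p}(K)=s^{\mathbb{Q}}(K)$ for all but finitely many primes $p$.
   Context: Bar-Natan complex. Let $R$ be a commutative ring with $1$ and $A=R[x]/\langle x^2-x\rangle$, with its multiplication, comultiplication $\Delta\colon A\to A\otimes A$, $\Delta(1)=1\otimes x+x\otimes 1-1\otimes 1$, $\Delta(x)=x\otimes x$, unit $R\subset A$, and counit $\varepsilon(x)=1$, $\varepsilon(1)=0$. For a link diagram $D$ with $n_+$ positive and $n_-$ negative crossings, the Bar-Natan complex $C_{\mathrm{BN}}^\ast(D;R)$ is obtained from the cube of smoothings of $D$ by Khovanov's construction with this Frobenius algebra: a vertex $v\in\{0,1\}^{n_++n_-}$ with smoothing $S$ contributes $C_S=A^{\otimes d_S}$ ($d_S$ the number of circles of $S$) in homological degree $|v|-n_-$, and edges of the cube act, up to the usual signs, by multiplication (merges) and $\Delta$ (splits). A standard generator $\xi_1\otimes\cdots\otimes\xi_{d_S}$, $\xi_i\in\{1,x\}$, has $q$-degree $\#\{i:\xi_i=1\}-\#\{i:\xi_i=x\}+|v|+n_+-2n_-$. The span $\mathcal{F}_q$ of the standard generators of $q$-degree $\ge q$ is a subcomplex, giving a descending filtration ($\mathcal{F}_{q+2}\subset\mathcal{F}_q$). Write $H_{\mathrm{BN}}^\ast(D;R)$ for the cohomology. For a knot diagram it is free of rank $2$ over $R$, concentrated in degree $0$. Rasmussen invariant over a field $\mathbb{F}$: for a knot $K$ with diagram $D$, $s^{\mathbb{F}}(K)=\max\{q\in 2\mathbb{Z}+1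 : \mathrm{im}(H^0(\mathcal{F}_q;\mathbb{F})\to H^0_{\mathrm{BN}}(D;\mathbb{F}))\neq 0\}-1$. It is an even integer, independent of $D$. $\mathbb{F}_p$ denotes the field with $p$ elements. *)

theory Defs
  imports
    "HOL-Analysis.Analysis"
    "HOL-Algebra.Algebraic_Closure_Type"
    "HOL-Algebra.AbelCoset"
    "HOL-Algebra.Module"
    "HOL-Number_Theory.Residues"
begin

section \<open>Knots in three-space\<close>

text \<open>A closed curve is a function of period 1; smooth means infinitely often differentiable.\<close>

definition smooth_knot_param :: "(real \<Rightarrow> real^3) \<Rightarrow> bool" where
  "smooth_knot_param \<gamma> \<longleftrightarrow>
     (\<exists>d :: nat \<Rightarrow> real \<Rightarrow> real^3. d 0 = \<gamma> \<and>
        (\<forall>k t. (d k has_vector_derivative d (Suc k) t) (at t))) \<and>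
     (\<forall>t. vector_derivative \<gamma> (at t) \<noteq> 0) \<and>
     (\<forall>t. \<gamma> (t + 1) = \<gamma> t) \<and>
     inj_on \<gamma> {0..<1}"

definition knot :: "(real^3) set \<Rightarrow> bool" where
  "knot K \<longleftrightarrow> (\<exists>\<gamma>. smooth_knot_param \<gamma> \<and> K = range \<gamma>)"

definition ambient_isotopic :: "(real^3) set \<Rightarrow> (real^3) set \<Rightarrow> bool" where
  "ambient_isotopic K K' \<longleftrightarrow>
     (\<exists>h :: real \<times> (real^3) \<Rightarrow> real^3.
        continuous_on ({0..1} \<times> UNIV) h \<and>
        (\<forall>t\<in>{0..1}. \<exists>g. homeomorphism UNIV UNIV (\<lambda>x. h (t, x)) g) \<and>
        (\<forall>x. h (0, x) = x) \<and>
        (\<lambda>x. h (1, x)) ` K = K')"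

section \<open>Link diagrams\<close>

text \<open>
  Planar diagram codes. The arcs of a diagram (edges of the underlying 4-valent plane graph,
  together with crossingless components) are numbered from 0. In \<open>Crossing s a b c d\<close> the arcs at
  the crossing are listed counterclockwise, \<open>a\<close> being the incoming and hence \<open>c\<close> the outgoing arc
  of the lower strand; \<open>s\<close> holds iff the crossing is positive.
\<close>

datatype crossing = Crossing (positive: bool) (arc0: nat) (arc1: nat) (arc2: nat) (arc3: nat)

datatype link_diagram = Diagram (num_arcs: nat) (crossings: "crossing list")

definition num_crossings :: "link_diagram \<Rightarrow> nat" where
  "num_crossings D = length (crossings D)"

definition n_pos :: "link_diagram \<Rightarrow> nat" where
  "n_pos D = length (filter positive (crossings D))"

definition n_neg :: "link_diagram \<Rightarrow> nat" where
  "n_neg D = length (filter (\<lambda>cr. \<not> positive cr) (crossings D))"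

subsection \<open>The diagram of a knot in general position\<close>

text \<open>Knots are projected along the third coordinate axis and viewed from above.\<close>

definition proj :: "real^3 \<Rightarrow> real \<times> real" where
  "proj x = (x $ 1, x $ 2)"

definition planar_det :: "real^3 \<Rightarrow> real^3 \<Rightarrow> real" where
  "planar_det u v = u $ 1 * v $ 2 - u $ 2 * v $ 1"

definition crossing_times :: "(real \<Rightarrow> real^3) \<Rightarrow> real set" where
  "crossing_times \<gamma> = {t \<in> {0..<1}. \<exists>s\<in>{0..<1}. s \<noteq> t \<and> proj (\<gamma> s) = proj (\<gamma> t)}"

definition general_position :: "(real \<Rightarrow> real^3) \<Rightarrow> bool" where
  "general_position \<gamma> \<longleftrightarrow>
     (\<forall>t. proj (vector_derivative \<gamma> (at t)) \<noteq> (0, 0)) \<and>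
     finite (crossing_times \<gamma>) \<and>
     (\<forall>s\<in>{0..<1}. \<forall>t\<in>{0..<1}. s \<noteq> t \<longrightarrow> proj (\<gamma> s) = proj (\<gamma> t) \<longrightarrow>
        planar_det (vector_derivative \<gamma> (at s)) (vector_derivative \<gamma> (at t)) \<noteq> 0 \<and>
        (\<forall>u\<in>{0..<1}. proj (\<gamma> u) = proj (\<gamma> s) \<longrightarrow> u = s \<or> u = t))"

definition partner :: "(real \<Rightarrow> real^3) \<Rightarrow> real \<Rightarrow> real" where
  "partner \<gamma> t = (THE s. s \<in> {0..<1} \<and> s \<noteq> t \<and> proj (\<gamma> s) = proj (\<gamma> t))"

text \<open>
  With crossing times \<open>t\<^sub>0 < \<dots> < t\<^sub>m\<^sub>-\<^sub>1\<close>, arc \<open>k\<close> is the piece of the curve ending at \<open>t\<^sub>k\<close>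
  (arc 0 passes through the parameter value \<open>0 = 1\<close>).
\<close>

definition arc_before :: "(real \<Rightarrow> real^3) \<Rightarrow> real \<Rightarrow> nat" where
  "arc_before \<gamma> t = card {r \<in> crossing_times \<gamma>. r < t}"

definition arc_after :: "(real \<Rightarrow> real^3) \<Rightarrow> real \<Rightarrow> nat" where
  "arc_after \<gamma> t = Suc (arc_before \<gamma> t) mod card (crossing_times \<gamma>)"

text \<open>The crossing whose lower strand passes at time \<open>t\<close>. It is positive iff the upper strand
  runs from left to right as seen along the lower strand.\<close>

definition crossing_at :: "(real \<Rightarrow> real^3) \<Rightarrow> real \<Rightarrow> crossing" where
  "crossing_at \<gamma> t =
     (let s = partner \<gamma> t in
      if planar_det (vector_derivative \<gamma> (at s)) (vector_derivative \<gamma> (at t)) > 0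
      then Crossing True  (arc_before \<gamma> t) (arc_after \<gamma> s) (arc_after \<gamma> t) (arc_before \<gamma> s)
      else Crossing False (arc_before \<gamma> t) (arc_before \<gamma> s) (arc_after \<gamma> t) (arc_after \<gamma> s))"

definition diagram_of :: "(real \<Rightarrow> real^3) \<Rightarrow> link_diagram" where
  "diagram_of \<gamma> =
     Diagram (max 1 (card (crossing_times \<gamma>)))
       (map (crossing_at \<gamma>)
         (sorted_list_of_set {t \<in> crossing_times \<gamma>. \<gamma> t $ 3 < \<gamma> (partner \<gamma> t) $ 3}))"

definition is_diagram_of :: "link_diagram \<Rightarrow> (real^3) set \<Rightarrow> bool" where
  "is_diagram_of D K \<longleftrightarrow>
     (\<exists>\<gamma>. smooth_knot_param \<gamma> \<and> general_position \<gamma> \<and>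
          ambient_isotopic K (range \<gamma>) \<and> D = diagram_of \<gamma>)"

section \<open>The cube of smoothings\<close>

text \<open>A vertex of the cube is given by the set of (indices of) crossings that are 1-smoothed.\<close>

definition joined_arcs :: "crossing \<Rightarrow> bool \<Rightarrow> (nat \<times> nat) set" where
  "joined_arcs cr b =
     (if b then {(arc0 cr, arc3 cr), (arc1 cr, arc2 cr)}
           else {(arc0 cr, arc1 cr), (arc2 cr, arc3 cr)})"

definition smoothing :: "link_diagram \<Rightarrow> nat set \<Rightarrow> (nat \<times> nat) set" where
  "smoothing D v = (\<Union>i<num_crossings D. joined_arcs (crossings D ! i) (i \<in> v))"

text \<open>Circles of a smoothing are represented by the sets of arcs they contain.\<close>

definition circle_of :: "link_diagram \<Rightarrow> nat set \<Rightarrow> nat \<Rightarrow> nat set" where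
  "circle_of D v a = {b. (a, b) \<in> (smoothing D v \<union> (smoothing D v)\<inverse>)\<^sup>*}"

definition circles :: "link_diagram \<Rightarrow> nat set \<Rightarrow> nat set set" where
  "circles D v = circle_of D v ` {..<num_arcs D}"

section \<open>The Bar-Natan complex\<close>

text \<open>The basis \<open>1, x\<close> of \<open>A = R[x]/(x\<^sup>2 - x)\<close>.\<close>

datatype basis = One | Ex

text \<open>Coefficient of \<open>c\<close> in the product \<open>a b\<close> in \<open>A\<close>.\<close>

fun mult_coeff :: "basis \<Rightarrow> basis \<Rightarrow> basis \<Rightarrow> int" where
  "mult_coeff One b c = (if c = b then 1 else 0)"
| "mult_coeff Ex One c = (if c = Ex then 1 else 0)"
| "mult_coeff Ex Ex c = (if c = Ex then 1 else 0)"

text \<open>Coefficient of \<open>b \<otimes> c\<close> in \<open>\<Delta>(a)\<close>, where \<open>\<Delta>(1) = 1 \<otimes> x + x \<otimes> 1 - 1 \<otimes> 1\<close> and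
  \<open>\<Delta>(x) = x \<otimes> x\<close>.\<close>

fun comult_coeff :: "basis \<Rightarrow> basis \<Rightarrow> basis \<Rightarrow> int" where
  "comult_coeff One One Ex = 1"
| "comult_coeff One Ex One = 1"
| "comult_coeff One One One = -1"
| "comult_coeff One Ex Ex = 0"
| "comult_coeff Ex b c = (if b = Ex \<and> c = Ex then 1 else 0)"

text \<open>A standard generator consists of a vertex and a labelling of the circles of its smoothing.\<close>

type_synonym generator = "nat set \<times> (nat set \<Rightarrow> basis)"

definition generators :: "link_diagram \<Rightarrow> generator set" where
  "generators D = (SIGMA v : Pow {..<num_crossings D}. circles D v \<rightarrow>\<^sub>E UNIV)"

definition hdeg :: "link_diagram \<Rightarrow> generator \<Rightarrow> int" where
  "hdeg D = (\<lambda>(v, \<xi>). int (card v) - int (n_neg D))"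

definition qdeg :: "link_diagram \<Rightarrow> generator \<Rightarrow> int" where
  "qdeg D = (\<lambda>(v, \<xi>).
     int (card {C \<in> circles D v. \<xi> C = One}) - int (card {C \<in> circles D v. \<xi> C = Ex})
     + int (card v) + int (n_pos D) - 2 * int (n_neg D))"

text \<open>
  Matrix entry of the map \<open>A\<^bsup>\<otimes>circles D v\<^esup> \<rightarrow> A\<^bsup>\<otimes>circles D (v \<union> {i})\<^esup>\<close> along the edge changing
  crossing \<open>i\<close>. Before the change the arcs 0, 1 at the crossing lie on \<open>a\<close> and the arcs 2, 3
  on \<open>b\<close>; afterwards the arcs 0, 3 lie on \<open>a'\<close> and the arcs 1, 2 on \<open>b'\<close>. The edge is a merge if
  \<open>a \<noteq> b\<close> and \<open>a' = b'\<close>, and a split if \<open>a = b\<close> and \<open>a' \<noteq> b'\<close>; nothing else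
  occurs for plane diagrams.
\<close>

definition edge_coeff ::
    "link_diagram \<Rightarrow> nat \<Rightarrow> nat set \<Rightarrow> (nat set \<Rightarrow> basis) \<Rightarrow> (nat set \<Rightarrow> basis) \<Rightarrow> int" where
  "edge_coeff D i v \<xi> \<eta> =
     (let cr = crossings D ! i; w = insert i v;
          a = circle_of D v (arc0 cr); b = circle_of D v (arc2 cr);
          a' = circle_of D w (arc0 cr); b' = circle_of D w (arc2 cr)
      in if \<forall>C \<in> circles D v - {a, b}. \<eta> C = \<xi> C
         then if a \<noteq> b \<and> a' = b' then mult_coeff (\<xi> a) (\<xi> b) (\<eta> a')
              else if a = b \<and> a' \<noteq> b' then comult_coeff (\<xi> a) (\<eta> a') (\<eta> b')
              else 0
         else 0)"

text \<open>Coefficient of the generator \<open>h\<close> in the differential of the generator \<open>g\<close>.\<close>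

definition diff_coeff :: "link_diagram \<Rightarrow> generator \<Rightarrow> generator \<Rightarrow> int" where
  "diff_coeff D g h =
     (case (g, h) of ((v, \<xi>), (w, \<eta>)) \<Rightarrow>
        \<Sum>i \<in> {..<num_crossings D} - v.
          if w = insert i v then (-1) ^ card {j \<in> v. j < i} * edge_coeff D i v \<xi> \<eta> else 0)"

text \<open>The free module on a set \<open>G\<close>; elements are represented by their coefficient functions,
  extended by zero. The fields \<^term>\<open>mult\<close> and \<^term>\<open>one\<close> of the record play no role.\<close>

definition free_module_on :: "('a, 'm) ring_scheme \<Rightarrow> 'g set \<Rightarrow> ('a, 'g \<Rightarrow> 'a) module" where
  "free_module_on R G =
     \<lparr> carrier = {f. (\<forall>g\<in>G. f g \<in> carrier R) \<and> (\<forall>g. g \<notin> G \<longrightarrow> f g = \<zero>\<^bsub>R\<^esub>)},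
       monoid.mult = undefined, one = undefined,
       ring.zero = (\<lambda>_. \<zero>\<^bsub>R\<^esub>), add = (\<lambda>f f' g. f g \<oplus>\<^bsub>R\<^esub> f' g),
       smult = (\<lambda>r f g. r \<otimes>\<^bsub>R\<^esub> f g) \<rparr>"

definition bn_differential ::
    "('a, 'm) ring_scheme \<Rightarrow> link_diagram \<Rightarrow> (generator \<Rightarrow> 'a) \<Rightarrow> generator \<Rightarrow> 'a" where
  "bn_differential R D f h =
     (if h \<in> generators D
      then \<Oplus>\<^bsub>R\<^esub>g\<in>generators D. [diff_coeff D g h] \<cdot>\<^bsub>R\<^esub> f g
      else \<zero>\<^bsub>R\<^esub>)"

text \<open>
  The following notions are relative to a family \<open>G\<close> of generators spanning a subcomplex:
  \<open>G i\<close> is the set of generators in homological degree \<open>i\<close>.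
\<close>

definition bn_gens :: "link_diagram \<Rightarrow> int \<Rightarrow> generator set" where
  "bn_gens D i = {g \<in> generators D. hdeg D g = i}"

definition filtered_gens :: "link_diagram \<Rightarrow> int \<Rightarrow> int \<Rightarrow> generator set" where
  "filtered_gens D q i = {g \<in> bn_gens D i. qdeg D g \<ge> q}"

definition cocycles ::
    "('a, 'm) ring_scheme \<Rightarrow> link_diagram \<Rightarrow> (int \<Rightarrow> generator set) \<Rightarrow> int \<Rightarrow> (generator \<Rightarrow> 'a) set"
  where
  "cocycles R D G i =
     {f \<in> carrier (free_module_on R (G i)). bn_differential R D f = (\<lambda>_. \<zero>\<^bsub>R\<^esub>)}"

definition coboundaries ::
    "('a, 'm) ring_scheme \<Rightarrow> link_diagram \<Rightarrow> (int \<Rightarrow> generator set) \<Rightarrow> int \<Rightarrow> (generator \<Rightarrow> 'a) set"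
  where
  "coboundaries R D G i = bn_differential R D ` carrier (free_module_on R (G (i - 1)))"

definition cohomology ::
    "('a, 'm) ring_scheme \<Rightarrow> link_diagram \<Rightarrow> (int \<Rightarrow> generator set) \<Rightarrow> int \<Rightarrow>
     (generator \<Rightarrow> 'a) set monoid" where
  "cohomology R D G i =
     (free_module_on R (G i))\<lparr>carrier := cocycles R D G i\<rparr> A_Mod coboundaries R D G i"

abbreviation bn_cohomology ::
    "('a, 'm) ring_scheme \<Rightarrow> link_diagram \<Rightarrow> int \<Rightarrow> (generator \<Rightarrow> 'a) set monoid" where
  "bn_cohomology R D \<equiv> cohomology R D (bn_gens D)"

abbreviation filtered_cohomology ::
    "('a, 'm) ring_scheme \<Rightarrow> link_diagram \<Rightarrow> int \<Rightarrow> int \<Rightarrow> (generator \<Rightarrow> 'a) set monoid" where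
  "filtered_cohomology R D q \<equiv> cohomology R D (filtered_gens D q)"

text \<open>The map induced on cohomology by the inclusion of the filtered subcomplex sends a coset
  \<open>z + B(\<F>\<^sub>q)\<close> to \<open>z + B\<close>, which as a set is the sum of \<open>B\<close> and \<open>z + B(\<F>\<^sub>q)\<close>.\<close>

definition inclusion_map ::
    "('a, 'm) ring_scheme \<Rightarrow> link_diagram \<Rightarrow> int \<Rightarrow> (generator \<Rightarrow> 'a) set \<Rightarrow> (generator \<Rightarrow> 'a) set"
  where
  "inclusion_map R D i c =
     coboundaries R D (bn_gens D) i <+>\<^bsub>free_module_on R (bn_gens D i)\<^esub> c"

section \<open>The Rasmussen invariant\<close>

text \<open>The set of odd \<open>q\<close> in question is not bounded below, so \<^term>\<open>Max\<close> does not apply.\<close>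

definition rasmussen :: "('a, 'm) ring_scheme \<Rightarrow> link_diagram \<Rightarrow> int" where
  "rasmussen F D =
     (GREATEST q. odd q \<and>
        inclusion_map F D 0 ` carrier (filtered_cohomology F D q 0)
          \<noteq> {\<one>\<^bsub>bn_cohomology F D 0\<^esub>}) - 1"

abbreviation prime_field :: "nat \<Rightarrow> int ring" where
  "prime_field p \<equiv> residue_ring (int p)"

abbreviation rat_field :: "rat ring" where
  "rat_field \<equiv> ring_of_type_algebra"

end

theory Submission
  imports Defs
begin

text \<open>
  For the given diagram, the statement is linear algebra about one finite integer matrix, the
  differential \<open>d\<close>. The map induced on degree zero cohomology by \<open>\<F>\<^sub>q\<close> is non-zero over a
  field \<open>F\<close> iff some vector supported in the set \<open>S\<close> of generators of \<open>\<F>\<^sub>q\<close> in degree zero lies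
  in the kernel of \<open>d\<close>, but not in the image of \<open>d\<close> from degree \<open>-1\<close> (\<open>inclusion_trivial_iff\<close>,
  \<open>cocycles_subset_iff\<close>). So the Rasmussen invariant over \<open>F\<close> is determined by the answers, for the
  finitely many sets \<open>S\<close> in degree zero, to the question whether the kernel of \<open>d\<close> on \<open>S\<close> lies in
  that image.

  For each \<open>S\<close> this question has the same answer over \<open>\<rat>\<close> and over \<open>\<int>/p\<close> for almost all primes \<open>p\<close>
  (\<open>finite_primes_kernel_in_image\<close>). Indeed, every integer matrix \<open>a\<close> has an integer matrix \<open>L\<close> and
  an integer \<open>N \<noteq> 0\<close> with \<open>a L a = N a\<close> (\<open>generalized_inverse_exists\<close>). Over a field in which \<open>N\<close>
  is invertible, the kernel of \<open>a\<close> is the image of \<open>N - L a\<close>, and the image of \<open>a\<close> is the kernel of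
  \<open>N - a L\<close>. An inclusion of a kernel in an image thus amounts to the vanishing of a product of two such
  integer matrices (\<open>kernel_in_image_iff\<close>). That product vanishes modulo almost all primes iff it
  vanishes over the integers, and this in turn is the condition over \<open>\<rat>\<close>.
\<close>

section \<open>Generalized inverses over an integral domain\<close>

text \<open>
  The equation says \<open>a L a = N a\<close> for matrices. The factor \<open>N\<close> replaces the division that an
  honest generalized inverse would need, so that integer matrices have integer solutions.
\<close>

definition generalized_inverse ::
    "'i set \<Rightarrow> 'j set \<Rightarrow> ('i \<Rightarrow> 'j \<Rightarrow> 'a) \<Rightarrow> 'a \<Rightarrow> ('j \<Rightarrow> 'i \<Rightarrow> 'a::comm_ring_1) \<Rightarrow> bool" where
  "generalized_inverse I J a N L \<longleftrightarrow>
    (\<forall>i\<in>I. \<forall>j\<in>J. (\<Sum>k\<in>J. a i k * (\<Sum>l\<in>I. L k l * a l j)) = N * a i j)"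

text \<open>
  The rows of \<open>a\<close> are treated one at a time. Given \<open>L\<close> for the rows in \<open>I\<close>, the columns of
  \<open>N - L a\<close> are killed by these rows. Either the new row kills them as well, and \<open>L\<close> still works, or
  the new row pairs with some column \<open>v\<close> to a non-zero value, and subtracting multiples of \<open>v\<close> from
  multiples of the columns, an elimination step without division, makes the new row kill all of them.
\<close>

lemma generalized_inverse_exists:
  fixes a :: "'i \<Rightarrow> 'j \<Rightarrow> 'a::idom"
  assumes "finite I" "finite J"
  shows "\<exists>N L. N \<noteq> 0 \<and> generalized_inverse I J a N L"
  unfolding generalized_inverse_def using assms(1)
proof (induction I rule: finite_induct)
  case empty
  show ?case by (rule exI[of _ 1]) simp
next
  case (insert i0 I)
  then obtain N L where "N \<noteq> 0" and
    NL: "\<And>i j. i \<in> I \<Longrightarrow> j \<in> J \<Longrightarrow> (\<Sum>k\<in>J. a i k * (\<Sum>l\<in>I. L k l * a l j)) = N * a i j"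
    by blast
  define La where "La k j = (\<Sum>l\<in>I. L k l * a l j)" for k j
  define u where "u j = N * a i0 j - (\<Sum>k\<in>J. a i0 k * La k j)" for j
  have aLa: "(\<Sum>k\<in>J. a i k * La k j) = N * a i j" if "i \<in> I" "j \<in> J" for i j
    using NL[OF that] by (simp add: La_def)
  show ?case
  proof (cases "\<forall>j\<in>J. u j = 0")
    case True
    define L' where "L' k l = (if l = i0 then 0 else L k l)" for k l
    have "(\<Sum>l\<in>insert i0 I. L' k l * a l j) = La k j" for k j
    proof -
      have "(\<Sum>l\<in>I. L' k l * a l j) = La k j"
        unfolding La_def using insert.hyps by (intro sum.cong) (auto simp: L'_def)
      then show ?thesis using insert.hyps by (simp add: L'_def)
    qed
    then have "(\<Sum>k\<in>J. a i k * (\<Sum>l\<in>insert i0 I. L' k l * a l j)) = N * a i j"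
      if "i \<in> insert i0 I" "j \<in> J" for i j
      using that aLa True by (auto simp: u_def)
    with \<open>N \<noteq> 0\<close> show ?thesis by blast
  next
    case False
    then obtain s where s: "s \<in> J" "u s \<noteq> 0" by blast
    \<comment> \<open>column \<open>s\<close> of \<open>N - L a\<close>; the rows in \<open>I\<close> kill it, row \<open>i0\<close> pairs with it to \<open>u s\<close>\<close>
    define v where "v k = (if k = s then N else 0) - La k s" for k
    have av: "(\<Sum>k\<in>J. a i k * v k) = N * a i s - (\<Sum>k\<in>J. a i k * La k s)" for i
    proof -
      have "(\<Sum>k\<in>J. a i k * (if k = s then N else 0)) = N * a i s"
        using s assms(2) by (simp add: if_distrib cong: if_cong)
      then show ?thesis by (simp add: v_def right_diff_distrib sum_subtractf)
    qed
    \<comment> \<open>chosen so that \<open>u s * N - L' a\<close> is \<open>u s (N - L a) - v u\<close>, which row \<open>i0\<close> also kills\<close>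
    define L' where "L' k l =
      (if l = i0 then N * v k else u s * L k l - v k * (\<Sum>k'\<in>J. a i0 k' * L k' l))" for k l
    have L'a: "(\<Sum>l\<in>insert i0 I. L' k l * a l j) = u s * La k j + v k * u j" for k j
    proof -
      have "(\<Sum>l\<in>I. L' k l * a l j)
          = (\<Sum>l\<in>I. u s * (L k l * a l j) - v k * (\<Sum>k'\<in>J. a i0 k' * (L k' l * a l j)))"
        using insert.hyps
        by (intro sum.cong) (auto simp: L'_def algebra_simps sum_distrib_left sum_distrib_right)
      also have "\<dots> = u s * La k j - v k * (\<Sum>l\<in>I. \<Sum>k'\<in>J. a i0 k' * (L k' l * a l j))"
        by (simp add: La_def sum_subtractf sum_distrib_left)
      also have "(\<Sum>l\<in>I. \<Sum>k'\<in>J. a i0 k' * (L k' l * a l j)) = (\<Sum>k'\<in>J. a i0 k' * La k' j)"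
        by (subst sum.swap) (simp add: La_def sum_distrib_left)
      finally show ?thesis
        using insert.hyps by (simp add: L'_def u_def algebra_simps)
    qed
    have "(\<Sum>k\<in>J. a i k * (\<Sum>l\<in>insert i0 I. L' k l * a l j)) = u s * N * a i j"
      if "i \<in> insert i0 I" "j \<in> J" for i j
    proof -
      have "(\<Sum>k\<in>J. a i k * (\<Sum>l\<in>insert i0 I. L' k l * a l j))
          = u s * (\<Sum>k\<in>J. a i k * La k j) + (\<Sum>k\<in>J. a i k * v k) * u j"
        unfolding L'a by (simp add: distrib_left sum.distrib sum_distrib_left sum_distrib_right mult_ac)
      also have "\<dots> = u s * N * a i j"
      proof (cases "i \<in> I")
        case True
        then show ?thesis using aLa s(1) that(2) by (simp add: av)
      next
        case False
        then have "i = i0" using that(1) by simp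
        moreover have "(\<Sum>k\<in>J. a i0 k * v k) = u s" by (simp add: av u_def)
        moreover have "(\<Sum>k\<in>J. a i0 k * La k j) = N * a i0 j - u j" by (simp add: u_def)
        ultimately show ?thesis by (simp only:) (simp add: algebra_simps)
      qed
      finally show ?thesis .
    qed
    moreover have "u s * N \<noteq> 0" using s \<open>N \<noteq> 0\<close> by simp
    ultimately show ?thesis by blast
  qed
qed

section \<open>A matrix deciding whether a kernel lies in an image\<close>

text \<open>
  If \<open>L\<close> is a generalized inverse of \<open>a\<close> with an invertible factor \<open>N\<close>, then \<open>N - L a\<close> is \<open>N\<close>
  times a projection onto the kernel of \<open>a\<close>, and \<open>N - a L\<close> is \<open>N\<close> times a projection whose kernel is the image of
  \<open>a\<close>.
\<close>

definition scaled_ker_proj ::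
    "'i set \<Rightarrow> ('i \<Rightarrow> 'j \<Rightarrow> 'a) \<Rightarrow> 'a \<Rightarrow> ('j \<Rightarrow> 'i \<Rightarrow> 'a) \<Rightarrow> 'j \<Rightarrow> 'j \<Rightarrow> 'a::comm_ring_1" where
  "scaled_ker_proj I a N L k j = (if k = j then N else 0) - (\<Sum>l\<in>I. L k l * a l j)"

definition scaled_coker_proj ::
    "'j set \<Rightarrow> ('i \<Rightarrow> 'j \<Rightarrow> 'a) \<Rightarrow> 'a \<Rightarrow> ('j \<Rightarrow> 'i \<Rightarrow> 'a) \<Rightarrow> 'i \<Rightarrow> 'i \<Rightarrow> 'a::comm_ring_1" where
  "scaled_coker_proj J a N L i l = (if i = l then N else 0) - (\<Sum>k\<in>J. a i k * L k l)"

lemma scaled_ker_proj_in_kernel: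
  assumes "generalized_inverse I J a N L" "finite J" "i \<in> I" "j \<in> J"
  shows "(\<Sum>k\<in>J. a i k * scaled_ker_proj I a N L k j) = 0"
proof -
  have "(\<Sum>k\<in>J. a i k * (if k = j then N else 0)) = N * a i j"
    using assms by (simp add: if_distrib cong: if_cong)
  then show ?thesis
    using assms(1,3,4)
    by (simp add: scaled_ker_proj_def generalized_inverse_def right_diff_distrib sum_subtractf)
qed

lemma scaled_coker_proj_kills_image:
  assumes "generalized_inverse I J a N L" "finite I" "i \<in> I" "j \<in> J"
  shows "(\<Sum>l\<in>I. scaled_coker_proj J a N L i l * a l j) = 0"
proof -
  have "(\<Sum>l\<in>I. (if i = l then N else 0) * a l j) = N * a i j"
    using assms by (simp add: if_distrib[of "\<lambda>x. x * _"] cong: if_cong)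
  moreover have "(\<Sum>l\<in>I. (\<Sum>k\<in>J. a i k * L k l) * a l j)
      = (\<Sum>k\<in>J. a i k * (\<Sum>l\<in>I. L k l * a l j))"
    by (simp add: sum_distrib_left sum_distrib_right mult_ac) (rule sum.swap)
  ultimately show ?thesis
    using assms(1,3,4)
    by (simp add: scaled_coker_proj_def generalized_inverse_def left_diff_distrib sum_subtractf)
qed

text \<open>
  The coefficients are those of the quotient ring \<open>'a/m\<close>. Divisibility by \<open>m\<close> in place of the quotient
  treats \<open>\<int>/p\<close> (\<open>m = p\<close> in the integers) and \<open>\<rat>\<close> (\<open>m = 0\<close> in the rationals) alike. The set \<open>S\<close>
  stands for the generators of a subcomplex, whose kernel is compared with the image in the complex.
\<close>

definition kernel_in_image ::
    "'a \<Rightarrow> 'h set \<Rightarrow> 'g set \<Rightarrow> 'g set \<Rightarrow> 'k set \<Rightarrow> ('h \<Rightarrow> 'g \<Rightarrow> 'a) \<Rightarrow>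
      ('g \<Rightarrow> 'k \<Rightarrow> 'a::comm_ring_1) \<Rightarrow> bool"
  where
  "kernel_in_image m H S T K a b \<longleftrightarrow>
    (\<forall>z. (\<forall>t. t \<notin> S \<longrightarrow> z t = 0) \<longrightarrow> (\<forall>h\<in>H. m dvd (\<Sum>s\<in>S. a h s * z s)) \<longrightarrow>
      (\<exists>y. \<forall>t\<in>T. m dvd z t - (\<Sum>k\<in>K. b t k * y k)))"

lemma dvd_cancel_unit_mod:
  fixes m :: "'a::comm_ring_1"
  assumes "m dvd u * N - 1" "m dvd N * x"
  shows "m dvd x"
proof -
  have "x = u * (N * x) - (u * N - 1) * x" by (simp add: algebra_simps)
  moreover have "m dvd u * (N * x)" "m dvd (u * N - 1) * x"
    using assms by (auto intro: dvd_mult dvd_mult2)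
  ultimately show ?thesis using dvd_diff by metis
qed

text \<open>
  Where the factors \<open>N\<close> and \<open>N'\<close> are invertible, the kernel of \<open>a\<close> is the image of \<open>N - L a\<close> and
  the image of \<open>b\<close> is the kernel of \<open>N' - b L'\<close>. Hence the one lies in the other exactly if the
  product \<open>(N' - b L') (N - L a)\<close> vanishes modulo \<open>m\<close>. For integer matrices
  \<open>a\<close> and \<open>b\<close>, it is an integer matrix that serves all \<open>m\<close> at once.
\<close>

lemma kernel_in_image_iff:
  fixes m :: "'a::comm_ring_1"
  assumes fin: "finite H" "finite T" "finite K" and "S \<subseteq> T"
    and a: "generalized_inverse H S a N L" and b: "generalized_inverse T K b N' L'"
    and units: "m dvd u * N - 1" "m dvd u' * N' - 1"
  shows "kernel_in_image m H S T K a b \<longleftrightarrow>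
    (\<forall>t\<in>T. \<forall>j\<in>S. m dvd (\<Sum>s\<in>S. scaled_coker_proj K b N' L' t s * scaled_ker_proj H a N L s j))"
    (is "_ \<longleftrightarrow> (\<forall>t\<in>T. \<forall>j\<in>S. m dvd ?E t j)")
proof
  have finS: "finite S" using fin \<open>S \<subseteq> T\<close> finite_subset by blast
  let ?P = "scaled_ker_proj H a N L" and ?Q = "scaled_coker_proj K b N' L'"
  {
    assume ker: "kernel_in_image m H S T K a b"
    show "\<forall>t\<in>T. \<forall>j\<in>S. m dvd ?E t j"
    proof (intro ballI)
      fix t j assume "t \<in> T" "j \<in> S"
      \<comment> \<open>column \<open>j\<close> of the projector is itself a kernel vector, hence in the image of \<open>b\<close>\<close>
      define z where "z s = (if s \<in> S then ?P s j else 0)" for s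
      have "(\<Sum>s\<in>S. a h s * z s) = 0" if "h \<in> H" for h
        using scaled_ker_proj_in_kernel[OF a finS that \<open>j \<in> S\<close>] by (simp add: z_def)
      then obtain y where y: "\<And>t. t \<in> T \<Longrightarrow> m dvd z t - (\<Sum>k\<in>K. b t k * y k)"
        using ker[unfolded kernel_in_image_def, rule_format, of z] by (auto simp: z_def)
      have "(\<Sum>s\<in>T. ?Q t s * (\<Sum>k\<in>K. b s k * y k)) = (\<Sum>k\<in>K. (\<Sum>s\<in>T. ?Q t s * b s k) * y k)"
        by (simp add: sum_distrib_left sum_distrib_right mult.assoc) (rule sum.swap)
      also have "\<dots> = 0"
        using scaled_coker_proj_kills_image[OF b fin(2) \<open>t \<in> T\<close>] by simp
      finally have Qb: "(\<Sum>s\<in>T. ?Q t s * (\<Sum>k\<in>K. b s k * y k)) = 0" .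
      have "?E t j = (\<Sum>s\<in>T. ?Q t s * z s)"
        using fin(2) \<open>S \<subseteq> T\<close> by (intro sum.mono_neutral_cong_left) (auto simp: z_def)
      also have "\<dots> = (\<Sum>s\<in>T. ?Q t s * (z s - (\<Sum>k\<in>K. b s k * y k)))"
        using Qb by (simp add: right_diff_distrib sum_subtractf)
      finally show "m dvd ?E t j" using y by (auto intro!: dvd_sum)
    qed
  }
  assume E: "\<forall>t\<in>T. \<forall>j\<in>S. m dvd ?E t j"
  show "kernel_in_image m H S T K a b"
    unfolding kernel_in_image_def
  proof (intro allI impI)
    fix z assume supp: "\<forall>t. t \<notin> S \<longrightarrow> z t = 0" and az: "\<forall>h\<in>H. m dvd (\<Sum>s\<in>S. a h s * z s)"
    have Pz: "N * z s = (\<Sum>j\<in>S. ?P s j * z j) + (\<Sum>h\<in>H. L s h * (\<Sum>j\<in>S. a h j * z j))"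
      if "s \<in> S" for s
    proof -
      have "(\<Sum>j\<in>S. (if s = j then N else 0) * z j) = N * z s"
        using that finS by (simp add: if_distrib[of "\<lambda>x. x * _"] cong: if_cong)
      moreover have "(\<Sum>j\<in>S. (\<Sum>h\<in>H. L s h * a h j) * z j) = (\<Sum>h\<in>H. L s h * (\<Sum>j\<in>S. a h j * z j))"
        by (simp add: sum_distrib_left sum_distrib_right mult.assoc) (rule sum.swap)
      ultimately show ?thesis
        by (simp add: scaled_ker_proj_def left_diff_distrib sum_subtractf)
    qed
    have Qz: "m dvd (\<Sum>s\<in>S. ?Q t s * z s)" if "t \<in> T" for t
    proof (rule dvd_cancel_unit_mod[OF units(1)])
      have "N * (\<Sum>s\<in>S. ?Q t s * z s) = (\<Sum>s\<in>S. ?Q t s * (N * z s))"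
        by (simp add: sum_distrib_left mult_ac)
      also have "\<dots> = (\<Sum>s\<in>S. ?Q t s * (\<Sum>j\<in>S. ?P s j * z j))
          + (\<Sum>s\<in>S. ?Q t s * (\<Sum>h\<in>H. L s h * (\<Sum>j\<in>S. a h j * z j)))"
        by (simp add: Pz distrib_left sum.distrib)
      also have "(\<Sum>s\<in>S. ?Q t s * (\<Sum>j\<in>S. ?P s j * z j)) = (\<Sum>j\<in>S. ?E t j * z j)"
        by (simp add: sum_distrib_left sum_distrib_right mult.assoc) (rule sum.swap)
      finally have "N * (\<Sum>s\<in>S. ?Q t s * z s) = (\<Sum>j\<in>S. ?E t j * z j)
          + (\<Sum>s\<in>S. ?Q t s * (\<Sum>h\<in>H. L s h * (\<Sum>j\<in>S. a h j * z j)))" .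
      moreover have "m dvd (\<Sum>j\<in>S. ?E t j * z j)"
        by (rule dvd_sum, rule dvd_mult2) (use E that in blast)
      moreover have "m dvd (\<Sum>s\<in>S. ?Q t s * (\<Sum>h\<in>H. L s h * (\<Sum>j\<in>S. a h j * z j)))"
        by (rule dvd_sum, rule dvd_mult, rule dvd_sum, rule dvd_mult) (use az in blast)
      ultimately show "m dvd N * (\<Sum>s\<in>S. ?Q t s * z s)" by (simp add: dvd_add)
    qed
    \<comment> \<open>as \<open>N' - b L'\<close> kills \<open>z\<close>, the generalized inverse produces a preimage\<close>
    define y where "y k = u' * (\<Sum>s\<in>S. L' k s * z s)" for k
    have "m dvd z t - (\<Sum>k\<in>K. b t k * y k)" if "t \<in> T" for t
    proof -
      have "(\<Sum>s\<in>S. (if t = s then N' else 0) * z s) = N' * z t"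
        using finS supp by (simp add: if_distrib[of "\<lambda>x. x * _"] cong: if_cong)
      moreover have "(\<Sum>s\<in>S. (\<Sum>k\<in>K. b t k * L' k s) * z s) = (\<Sum>k\<in>K. b t k * (\<Sum>s\<in>S. L' k s * z s))"
        by (simp add: sum_distrib_left sum_distrib_right mult.assoc) (rule sum.swap)
      ultimately have "(\<Sum>s\<in>S. ?Q t s * z s) = N' * z t - (\<Sum>k\<in>K. b t k * (\<Sum>s\<in>S. L' k s * z s))"
        by (simp add: scaled_coker_proj_def left_diff_distrib sum_subtractf)
      moreover have "(\<Sum>k\<in>K. b t k * y k) = u' * (\<Sum>k\<in>K. b t k * (\<Sum>s\<in>S. L' k s * z s))"
        by (simp add: y_def sum_distrib_left mult_ac)
      ultimately have "z t - (\<Sum>k\<in>K. b t k * y k)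
          = u' * (\<Sum>s\<in>S. ?Q t s * z s) - (u' * N' - 1) * z t"
        by (simp only:) (simp add: algebra_simps)
      then show ?thesis using Qz[OF that] units(2) by (simp add: dvd_diff)
    qed
    then show "\<exists>y. \<forall>t\<in>T. m dvd z t - (\<Sum>k\<in>K. b t k * y k)" by blast
  qed
qed

lemma of_int_scaled_ker_proj:
  "of_int (scaled_ker_proj I a N L k j) =
     scaled_ker_proj I (\<lambda>i j. of_int (a i j)) (of_int N) (\<lambda>k l. of_int (L k l)) k j"
  by (simp add: scaled_ker_proj_def)

lemma of_int_scaled_coker_proj:
  "of_int (scaled_coker_proj J a N L i l) =
     scaled_coker_proj J (\<lambda>i j. of_int (a i j)) (of_int N) (\<lambda>k l. of_int (L k l)) i l"
  by (simp add: scaled_coker_proj_def)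

lemma generalized_inverse_of_int:
  assumes "generalized_inverse I J a N L"
  shows "generalized_inverse I J (\<lambda>i j. of_int (a i j)) (of_int N) (\<lambda>k l. of_int (L k l))"
  unfolding generalized_inverse_def
proof (intro ballI)
  fix i j assume "i \<in> I" "j \<in> J"
  then have "(\<Sum>k\<in>J. a i k * (\<Sum>l\<in>I. L k l * a l j)) = N * a i j"
    using assms by (simp add: generalized_inverse_def)
  from arg_cong[OF this, of of_int]
  show "(\<Sum>k\<in>J. of_int (a i k) * (\<Sum>l\<in>I. of_int (L k l) * of_int (a l j)))
      = of_int N * of_int (a i j)"
    by simp
qed

text \<open>
  One integer matrix \<open>E\<close> decides the question over \<open>\<rat>\<close> and over all \<open>\<int>/p\<close> with \<open>p\<close> not dividing
  the factors \<open>N\<close>, \<open>N'\<close>. If \<open>E = 0\<close> all these answers agree; otherwise they agree for every \<open>p\<close>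
  that also does not divide a chosen non-zero entry \<open>e\<close> of \<open>E\<close>.
\<close>

lemma finite_primes_kernel_in_image:
  fixes a :: "'h \<Rightarrow> 'g \<Rightarrow> int" and b :: "'g \<Rightarrow> 'k \<Rightarrow> int"
  assumes fin: "finite H" "finite T" "finite K" and "S \<subseteq> T"
  shows "finite {p::nat. Factorial_Ring.prime p \<and> kernel_in_image (int p) H S T K a b \<noteq>
    kernel_in_image (0::rat) H S T K (\<lambda>h g. of_int (a h g)) (\<lambda>g k. of_int (b g k))}"
proof -
  have finS: "finite S" using fin \<open>S \<subseteq> T\<close> finite_subset by blast
  obtain N L where N: "N \<noteq> 0" and a: "generalized_inverse H S a N L"
    using generalized_inverse_exists[OF fin(1) finS, of a] by blast
  obtain N' L' where N': "N' \<noteq> 0" and b: "generalized_inverse T K b N' L'"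
    using generalized_inverse_exists[OF fin(2,3), of b] by blast
  define E where "E t j = (\<Sum>s\<in>S. scaled_coker_proj K b N' L' t s * scaled_ker_proj H a N L s j)" for t j
  have rat: "kernel_in_image (0::rat) H S T K (\<lambda>h g. of_int (a h g)) (\<lambda>g k. of_int (b g k))
      \<longleftrightarrow> (\<forall>t\<in>T. \<forall>j\<in>S. E t j = 0)"
  proof -
    have "(\<Sum>s\<in>S.
          scaled_coker_proj K (\<lambda>i j. of_int (b i j)) (of_int N') (\<lambda>k l. of_int (L' k l)) t s
        * scaled_ker_proj H (\<lambda>i j. of_int (a i j)) (of_int N) (\<lambda>k l. of_int (L k l)) s j)
        = (of_int (E t j) :: rat)" for t j
      by (simp add: E_def of_int_scaled_ker_proj of_int_scaled_coker_proj)
    then show ?thesis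
      using N N' kernel_in_image_iff[OF fin \<open>S \<subseteq> T\<close>
          generalized_inverse_of_int[OF a] generalized_inverse_of_int[OF b],
        of "0::rat" "1 / of_int N" "1 / of_int N'"]
      by simp
  qed
  obtain e where "e \<noteq> 0" and e: "\<And>p. \<not> int p dvd e \<Longrightarrow>
    (\<forall>t\<in>T. \<forall>j\<in>S. int p dvd E t j) \<longleftrightarrow> (\<forall>t\<in>T. \<forall>j\<in>S. E t j = 0)"
  proof (cases "\<forall>t\<in>T. \<forall>j\<in>S. E t j = 0")
    case True
    then show ?thesis by (intro that[of 1]) auto
  next
    case False
    then obtain t j where "t \<in> T" "j \<in> S" "E t j \<noteq> 0" by blast
    then show ?thesis by (intro that[of "E t j"]) blast+
  qed
  have iff: "kernel_in_image (int p) H S T K a b \<longleftrightarrow>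
      kernel_in_image (0::rat) H S T K (\<lambda>h g. of_int (a h g)) (\<lambda>g k. of_int (b g k))"
    if p: "Factorial_Ring.prime p" "\<not> int p dvd N * N' * e" for p
  proof -
    have inv: "\<exists>u. int p dvd u * x - 1" if "\<not> int p dvd x" for x
    proof -
      have "coprime x (int p)"
        using p(1) that by (metis coprime_commute prime_imp_coprime prime_nat_int_transfer)
      then obtain u where "[x * u = 1] (mod int p)" using cong_solve_coprime_int by blast
      then show ?thesis by (metis cong_iff_dvd_diff mult.commute)
    qed
    have "\<not> int p dvd N" "\<not> int p dvd N'" "\<not> int p dvd e"
      using p(2) by auto
    moreover then obtain u u' where "int p dvd u * N - 1" "int p dvd u' * N' - 1"
      using inv by meson
    ultimately show ?thesis
      using kernel_in_image_iff[OF fin \<open>S \<subseteq> T\<close> a b, of "int p" u u'] rat e[of p]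
      by (simp add: E_def)
  qed
  have "{p::nat. Factorial_Ring.prime p \<and> kernel_in_image (int p) H S T K a b \<noteq>
    kernel_in_image (0::rat) H S T K (\<lambda>h g. of_int (a h g)) (\<lambda>g k. of_int (b g k))}
    \<subseteq> {p. p dvd nat \<bar>N * N' * e\<bar>}"
    using iff by (auto simp: int_dvd_int_iff[symmetric] simp del: abs_mult)
  moreover have "finite {p. p dvd nat \<bar>N * N' * e\<bar>}"
    using N N' \<open>e \<noteq> 0\<close> by (intro finite_divisors_nat) auto
  ultimately show ?thesis by (rule finite_subset)
qed

section \<open>The Bar-Natan complex over a quotient ring\<close>

lemma finite_generators: "finite (generators D)"
  unfolding generators_def circles_def
proof (intro finite_SigmaI finite_PiE)
  show "finite (UNIV :: basis set)"
    by (rule finite_subset[of _ "{One, Ex}"]) (auto intro: basis.exhaust)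
qed auto

lemma bn_gens_subset: "bn_gens D i \<subseteq> generators D"
  and filtered_gens_subset: "filtered_gens D q i \<subseteq> bn_gens D i"
  by (auto simp: bn_gens_def filtered_gens_def)

text \<open>
  The coefficient ring is presented as \<open>'a/m\<close> by a surjection \<open>\<rho>\<close>, so that chains lift to functions
  with values in the type \<open>'a\<close>, where sums are those of the type class.
\<close>

locale quotient_ring_coefficients =
  ring_hom_cring "ring_of_type_algebra :: 'a ring" R \<rho>
  for R (structure) and \<rho> :: "'a::comm_ring_1 \<Rightarrow> 'r" +
  fixes m :: 'a
  assumes surj: "range \<rho> = carrier R"
    and kernel: "\<rho> x = \<zero> \<longleftrightarrow> m dvd x"
begin

lemma rho_closed [simp]: "\<rho> x \<in> carrier R"
  using surj by auto

lemma rho_add: "\<rho> (x + y) = \<rho> x \<oplus> \<rho> y"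
  using hom_add[of x y] by (simp add: ring_of_type_algebra_def)

lemma rho_zero [simp]: "\<rho> 0 = \<zero>"
  by (simp add: kernel)

lemma rho_minus: "\<rho> (- x) = \<ominus> \<rho> x"
proof -
  have "\<rho> (- x) \<oplus> \<rho> x = \<zero>" by (simp flip: rho_add)
  then show ?thesis by (metis rho_closed S.minus_equality)
qed

lemma rho_eq_iff: "\<rho> x = \<rho> y \<longleftrightarrow> m dvd x - y"
proof -
  have "\<rho> x = \<rho> (x - y) \<oplus> \<rho> y" by (simp flip: rho_add)
  then show ?thesis using kernel[of "x - y"] by (metis S.add.r_cancel_one' S.l_zero rho_closed)
qed

lemma rho_of_nat_mult: "\<rho> (of_nat n * x) = [n] \<cdot> \<rho> x"
  by (induction n) (simp_all add: rho_add distrib_right S.a_comm)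

lemma rho_of_int_mult: "\<rho> (of_int k * x) = [k] \<cdot> \<rho> x"
proof (cases "k \<ge> 0")
  case True
  then show ?thesis using rho_of_nat_mult[of "nat k" x] by (simp add: add_pow_int_ge)
next
  case False
  then show ?thesis
    using rho_of_nat_mult[of "nat (- k)" x] rho_minus[of "of_nat (nat (- k)) * x"]
    by (simp add: add_pow_int_lt)
qed

lemma rho_sum: "\<rho> (sum f A) = (\<Oplus>a\<in>A. \<rho> (f a))"
  by (induction A rule: infinite_finite_induct) (simp_all add: rho_add)

definition lifted_differential :: "link_diagram \<Rightarrow> (generator \<Rightarrow> 'a) \<Rightarrow> generator \<Rightarrow> 'a" where
  "lifted_differential D f h =
    (if h \<in> generators D then \<Sum>g\<in>generators D. of_int (diff_coeff D g h) * f g else 0)"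

lemma bn_differential_rho:
  "bn_differential R D (\<lambda>g. \<rho> (f g)) = (\<lambda>h. \<rho> (lifted_differential D f h))"
  by (rule ext) (simp add: bn_differential_def lifted_differential_def rho_sum rho_of_int_mult)

lemma free_module_carrier:
  "carrier (free_module_on R G) = (\<lambda>f g. \<rho> (f g)) ` {f. \<forall>g. g \<notin> G \<longrightarrow> f g = 0}"
proof (intro equalityI subsetI)
  fix f assume f: "f \<in> carrier (free_module_on R G)"
  then have "\<forall>g. \<exists>x. f g = \<rho> x \<and> (g \<notin> G \<longrightarrow> x = 0)"
    using surj by (simp add: free_module_on_def) (metis imageE rho_zero)
  then obtain f' where "\<And>g. f g = \<rho> (f' g) \<and> (g \<notin> G \<longrightarrow> f' g = 0)" by metis
  then show "f \<in> (\<lambda>f g. \<rho> (f g)) ` {f. \<forall>g. g \<notin> G \<longrightarrow> f g = 0}"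
    by (intro image_eqI[of _ _ f']) auto
qed (auto simp: free_module_on_def)

lemma coboundaries_rho:
  "coboundaries R D G i =
    (\<lambda>f h. \<rho> (lifted_differential D f h)) ` {f. \<forall>g. g \<notin> G (i - 1) \<longrightarrow> f g = 0}"
  by (simp add: coboundaries_def free_module_carrier image_image bn_differential_rho)

text \<open>
  As a set, the image of the class of \<open>z\<close> is \<open>B + (B\<^sub>q + z)\<close>, with \<open>B\<close> and \<open>B\<^sub>q\<close> the coboundaries of
  the whole and of the filtered complex. Since \<open>B\<^sub>q \<subseteq> B\<close> and \<open>B\<close> is an additive group, this is the
  coset \<open>B + z\<close>.
\<close>

lemma inclusion_map_coset_trivial_iff:
  assumes "z \<in> cocycles R D (filtered_gens D q) i"
  shows "inclusion_map R D i (coboundaries R D (filtered_gens D q) i +>\<^bsub>free_module_on R G\<^esub> z)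
      = coboundaries R D (bn_gens D) i \<longleftrightarrow> z \<in> coboundaries R D (bn_gens D) i"
    (is "inclusion_map R D i (?Bq +>\<^bsub>_\<^esub> z) = ?B \<longleftrightarrow> _")
proof -
  obtain z' where z': "z = (\<lambda>g. \<rho> (z' g))"
    using assms unfolding cocycles_def free_module_carrier by auto
  have zero: "(\<lambda>_. \<zero>) \<in> ?B" "(\<lambda>_. \<zero>) \<in> ?Bq"
    unfolding coboundaries_rho by (auto simp: lifted_differential_def intro!: image_eqI[of _ _ "\<lambda>_. 0"])
  have sub: "?Bq \<subseteq> ?B"
    unfolding coboundaries_rho using filtered_gens_subset by (intro image_mono) blast
  have add: "(\<lambda>g. f g \<oplus> f' g) \<in> ?B" if ff': "f \<in> ?B" "f' \<in> ?B" for f f'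
  proof -
    obtain b b' where b: "f = (\<lambda>h. \<rho> (lifted_differential D b h))"
        "\<And>g. g \<notin> bn_gens D (i - 1) \<Longrightarrow> b g = 0"
      and b': "f' = (\<lambda>h. \<rho> (lifted_differential D b' h))"
        "\<And>g. g \<notin> bn_gens D (i - 1) \<Longrightarrow> b' g = 0"
      using ff' unfolding coboundaries_rho by blast
    show ?thesis
      unfolding coboundaries_rho
      by (rule image_eqI[of _ _ "\<lambda>g. b g + b' g"])
        (auto simp: b b' lifted_differential_def rho_add sum.distrib distrib_left)
  qed
  have diff: "(\<lambda>g. f g \<oplus> \<rho> (- f' g)) \<in> ?B" if ff': "f \<in> ?B" "(\<lambda>g. \<rho> (f' g)) \<in> ?B" for f f'
  proof -
    obtain b where b: "(\<lambda>g. \<rho> (f' g)) = (\<lambda>h. \<rho> (lifted_differential D b h))"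
        "\<And>g. g \<notin> bn_gens D (i - 1) \<Longrightarrow> b g = 0"
      using ff'(2) unfolding coboundaries_rho by blast
    have "(\<lambda>g. \<rho> (- f' g)) \<in> ?B"
      unfolding coboundaries_rho
      using b(2) fun_cong[OF b(1)]
      by (intro image_eqI[of _ _ "\<lambda>g. - b g"])
        (auto simp: lifted_differential_def rho_minus sum_negf)
    from add[OF ff'(1) this] show ?thesis .
  qed
  have "inclusion_map R D i (?Bq +>\<^bsub>free_module_on R G\<^esub> z)
      = {(\<lambda>g. f g \<oplus> (f' g \<oplus> z g)) | f f'. f \<in> ?B \<and> f' \<in> ?Bq}"
    unfolding inclusion_map_def set_add_def' a_r_coset_def' by (auto simp: free_module_on_def)
  also have "\<dots> = ?B \<longleftrightarrow> z \<in> ?B"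
  proof
    have "z = (\<lambda>g. \<zero> \<oplus> (\<zero> \<oplus> z g))" by (simp add: z')
    with zero have "z \<in> {(\<lambda>g. f g \<oplus> (f' g \<oplus> z g)) | f f'. f \<in> ?B \<and> f' \<in> ?Bq}"
      by (intro CollectI exI[of _ "\<lambda>_. \<zero>"] conjI)
    moreover assume "{(\<lambda>g. f g \<oplus> (f' g \<oplus> z g)) | f f'. f \<in> ?B \<and> f' \<in> ?Bq} = ?B"
    ultimately show "z \<in> ?B" by (rule back_subst[of "\<lambda>A. z \<in> A"])
  next
    assume z: "z \<in> ?B"
    show "{(\<lambda>g. f g \<oplus> (f' g \<oplus> z g)) | f f'. f \<in> ?B \<and> f' \<in> ?Bq} = ?B"
    proof (intro equalityI subsetI)
      fix f assume f: "f \<in> ?B"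
      then obtain b where b: "f = (\<lambda>g. \<rho> (b g))" unfolding coboundaries_rho by auto
      have "f = (\<lambda>g. (f g \<oplus> \<rho> (- z' g)) \<oplus> (\<zero> \<oplus> z g))"
        by (simp add: b z' flip: rho_add rho_zero)
      moreover have "(\<lambda>g. f g \<oplus> \<rho> (- z' g)) \<in> ?B" using diff[OF f] z by (simp add: z')
      ultimately show "f \<in> {(\<lambda>g. f g \<oplus> (f' g \<oplus> z g)) | f f'. f \<in> ?B \<and> f' \<in> ?Bq}"
        using zero(2) by (intro CollectI exI conjI) auto
    next
      fix y assume "y \<in> {(\<lambda>g. f g \<oplus> (f' g \<oplus> z g)) | f f'. f \<in> ?B \<and> f' \<in> ?Bq}"
      then obtain f f' where "f \<in> ?B" "f' \<in> ?Bq" "y = (\<lambda>g. f g \<oplus> (f' g \<oplus> z g))" by blast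
      then show "y \<in> ?B" using add[OF _ add[OF _ z]] sub by blast
    qed
  qed
  finally show ?thesis .
qed

lemma inclusion_trivial_iff:
  "inclusion_map R D i ` carrier (filtered_cohomology R D q i) = {\<one>\<^bsub>bn_cohomology R D i\<^esub>}
    \<longleftrightarrow> cocycles R D (filtered_gens D q) i \<subseteq> coboundaries R D (bn_gens D) i"
proof -
  let ?Z = "cocycles R D (filtered_gens D q) i" and ?M = "free_module_on R (filtered_gens D q i)"
  have "lifted_differential D (\<lambda>_. 0) = (\<lambda>_. 0)"
    by (simp add: lifted_differential_def fun_eq_iff)
  then have z0: "(\<lambda>_. \<zero>) \<in> ?Z"
    unfolding cocycles_def using bn_differential_rho[of D "\<lambda>_. 0"]
    by (simp add: free_module_on_def)
  have "carrier (filtered_cohomology R D q i)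
      = (\<lambda>z. coboundaries R D (filtered_gens D q) i +>\<^bsub>?M\<^esub> z) ` ?Z"
    by (auto simp: cohomology_def A_FactGroup_def FactGroup_def RCOSETS_def a_r_coset_def r_coset_def)
  moreover have "\<one>\<^bsub>bn_cohomology R D i\<^esub> = coboundaries R D (bn_gens D) i"
    by (simp add: cohomology_def A_FactGroup_def)
  moreover define F where
    "F z = inclusion_map R D i (coboundaries R D (filtered_gens D q) i +>\<^bsub>?M\<^esub> z)" for z
  ultimately have
    "inclusion_map R D i ` carrier (filtered_cohomology R D q i) = {\<one>\<^bsub>bn_cohomology R D i\<^esub>}
      \<longleftrightarrow> F ` ?Z = {coboundaries R D (bn_gens D) i}"
    by (simp add: image_image)
  also have "\<dots> \<longleftrightarrow> (\<forall>z\<in>?Z. F z = coboundaries R D (bn_gens D) i)"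
    using z0 by (auto simp: set_eq_iff image_iff)
  also have "\<dots> \<longleftrightarrow> (\<forall>z\<in>?Z. z \<in> coboundaries R D (bn_gens D) i)"
    unfolding F_def by (intro ball_cong refl inclusion_map_coset_trivial_iff)
  finally show ?thesis by blast
qed

lemma cocycles_subset_iff:
  "cocycles R D (filtered_gens D q) i \<subseteq> coboundaries R D (bn_gens D) i \<longleftrightarrow>
    kernel_in_image m (generators D) (filtered_gens D q i) (generators D) (bn_gens D (i - 1))
      (\<lambda>h g. of_int (diff_coeff D g h)) (\<lambda>h g. of_int (diff_coeff D g h))"
    (is "_ \<longleftrightarrow> kernel_in_image m ?T ?S ?T ?K ?d ?d")
proof -
  have sub: "?S \<subseteq> ?T" "?K \<subseteq> ?T" using bn_gens_subset filtered_gens_subset by blast+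
  have ld: "lifted_differential D f h = (\<Sum>g\<in>G. ?d h g * f g)"
    if "h \<in> ?T" "\<forall>g. g \<notin> G \<longrightarrow> f g = 0" "G \<subseteq> ?T" for f G h
    using that finite_generators by (auto simp: lifted_differential_def intro!: sum.mono_neutral_right)
  have cocycle: "(\<lambda>g. \<rho> (z g)) \<in> cocycles R D (filtered_gens D q) i \<longleftrightarrow>
      (\<forall>h\<in>?T. m dvd (\<Sum>g\<in>?S. ?d h g * z g))"
    if "\<forall>g. g \<notin> ?S \<longrightarrow> z g = 0" for z
  proof -
    have "(\<lambda>g. \<rho> (z g)) \<in> carrier (free_module_on R ?S)"
      using that unfolding free_module_carrier by blast
    then have "(\<lambda>g. \<rho> (z g)) \<in> cocycles R D (filtered_gens D q) i \<longleftrightarrow>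
        (\<forall>h. m dvd lifted_differential D z h)"
      by (simp add: cocycles_def bn_differential_rho fun_eq_iff kernel)
    also have "\<dots> \<longleftrightarrow> (\<forall>h\<in>?T. m dvd lifted_differential D z h)"
      by (auto simp: lifted_differential_def)
    finally show ?thesis using ld[OF _ that sub(1)] by simp
  qed
  have coboundary: "(\<lambda>g. \<rho> (z g)) \<in> coboundaries R D (bn_gens D) i \<longleftrightarrow>
      (\<exists>y. \<forall>h\<in>?T. m dvd z h - (\<Sum>g\<in>?K. ?d h g * y g))"
    if z: "\<forall>g. g \<notin> ?S \<longrightarrow> z g = 0" for z
  proof -
    have "(\<lambda>g. \<rho> (z g)) = (\<lambda>h. \<rho> (lifted_differential D y h)) \<longleftrightarrow>
        (\<forall>h\<in>?T. m dvd z h - lifted_differential D y h)" for y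
    proof -
      have "z h = 0" if "h \<notin> ?T" for h using z sub(1) that by blast
      then show ?thesis by (auto simp: fun_eq_iff rho_eq_iff lifted_differential_def)
    qed
    then have "(\<lambda>g. \<rho> (z g)) \<in> coboundaries R D (bn_gens D) i \<longleftrightarrow>
        (\<exists>y. (\<forall>g. g \<notin> ?K \<longrightarrow> y g = 0) \<and> (\<forall>h\<in>?T. m dvd z h - lifted_differential D y h))"
      unfolding coboundaries_rho by auto
    also have "\<dots> \<longleftrightarrow>
        (\<exists>y. (\<forall>g. g \<notin> ?K \<longrightarrow> y g = 0) \<and> (\<forall>h\<in>?T. m dvd z h - (\<Sum>g\<in>?K. ?d h g * y g)))"
      using ld[OF _ _ sub(2)] by (intro arg_cong[where f = HOL.Ex] ext conj_cong) auto
    also have "\<dots> \<longleftrightarrow> (\<exists>y. \<forall>h\<in>?T. m dvd z h - (\<Sum>g\<in>?K. ?d h g * y g))"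
    proof
      assume "\<exists>y. \<forall>h\<in>?T. m dvd z h - (\<Sum>g\<in>?K. ?d h g * y g)"
      then obtain y where "\<forall>h\<in>?T. m dvd z h - (\<Sum>g\<in>?K. ?d h g * y g)" by blast
      then show "\<exists>y. (\<forall>g. g \<notin> ?K \<longrightarrow> y g = 0) \<and>
          (\<forall>h\<in>?T. m dvd z h - (\<Sum>g\<in>?K. ?d h g * y g))"
        by (intro exI[of _ "\<lambda>g. if g \<in> ?K then y g else 0"]) simp
    qed blast
    finally show ?thesis .
  qed
  have "cocycles R D (filtered_gens D q) i \<subseteq> (\<lambda>f g. \<rho> (f g)) ` {f. \<forall>g. g \<notin> ?S \<longrightarrow> f g = 0}"
    unfolding cocycles_def free_module_carrier[symmetric] by blast
  then have "cocycles R D (filtered_gens D q) i \<subseteq> coboundaries R D (bn_gens D) i \<longleftrightarrow>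
    (\<forall>z. (\<forall>g. g \<notin> ?S \<longrightarrow> z g = 0) \<longrightarrow> (\<lambda>g. \<rho> (z g)) \<in> cocycles R D (filtered_gens D q) i \<longrightarrow>
      (\<lambda>g. \<rho> (z g)) \<in> coboundaries R D (bn_gens D) i)"
    by blast
  then show ?thesis
    unfolding kernel_in_image_def using cocycle coboundary by auto
qed

lemma rasmussen_eq:
  "rasmussen R D = (GREATEST q. odd q \<and> \<not> kernel_in_image m
      (generators D) (filtered_gens D q 0) (generators D) (bn_gens D (- 1))
      (\<lambda>h g. of_int (diff_coeff D g h)) (\<lambda>h g. of_int (diff_coeff D g h))) - 1"
  by (simp add: rasmussen_def inclusion_trivial_iff cocycles_subset_iff)

end

section \<open>Comparison of the Rasmussen invariants\<close>

lemma quotient_ring_coefficients_prime_field: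
  assumes "Factorial_Ring.prime p"
  shows "quotient_ring_coefficients (prime_field p) (\<lambda>x. x mod int p) (int p)"
proof -
  have p: "int p > 1" using assms prime_gt_1_nat by simp
  interpret residues "int p" "prime_field p"
    by unfold_locales (use p in auto)
  interpret Z: cring "ring_of_type_algebra :: int ring" by (rule cring_from_type_algebra)
  show ?thesis
  proof
    show "(\<lambda>x. x mod int p) \<in> ring_hom ring_of_type_algebra (prime_field p)"
      using p by (auto simp: ring_hom_def ring_of_type_algebra_def residue_ring_def mod_simps)
    show "range (\<lambda>x. x mod int p) = carrier (prime_field p)"
    proof (intro equalityI subsetI)
      fix y assume "y \<in> carrier (prime_field p)"
      then have "y = y mod int p" by (simp add: res_carrier_eq)
      then show "y \<in> range (\<lambda>x. x mod int p)" by blast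
    qed (use p in \<open>auto simp: res_carrier_eq\<close>)
    show "(x mod int p = \<zero>\<^bsub>prime_field p\<^esub>) = (int p dvd x)" for x
      by (simp add: res_zero_eq dvd_eq_mod_eq_0)
  qed
qed

lemma quotient_ring_coefficients_rat: "quotient_ring_coefficients rat_field (\<lambda>x. x) 0"
proof -
  interpret cring rat_field by (rule cring_from_type_algebra)
  show ?thesis
  proof
    show "(\<lambda>x. x) \<in> ring_hom ring_of_type_algebra rat_field" by (simp add: ring_hom_def)
    show "range (\<lambda>x. x) = carrier rat_field" by (simp add: ring_of_type_algebra_def)
    show "(x = \<zero>\<^bsub>rat_field\<^esub>) = (0 dvd x)" for x by (simp add: ring_of_type_algebra_def)
  qed
qed

theorem corollary4p7:
  fixes K :: "(real^3) set" and D :: link_diagram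
  assumes "knot K" and "is_diagram_of D K"
  shows "finite {p :: nat. Factorial_Ring.prime p \<and> rasmussen (prime_field p) D \<noteq> rasmussen rat_field D}"
proof -
  let ?d = "\<lambda>h g. diff_coeff D g h"
  define P where "P p S \<longleftrightarrow>
    kernel_in_image (int p) (generators D) S (generators D) (bn_gens D (- 1)) ?d ?d" for p S
  define Q where "Q S \<longleftrightarrow>
    kernel_in_image (0::rat) (generators D) S (generators D) (bn_gens D (- 1))
    (\<lambda>h g. of_int (?d h g)) (\<lambda>h g. of_int (?d h g))" for S
  have fin: "finite (bn_gens D i)" for i
    by (rule finite_subset[OF bn_gens_subset finite_generators])
  \<comment> \<open>Infinitely many \<open>q\<close> occur, but only finitely many sets \<open>S = filtered_gens D q 0\<close>.\<close>
  let ?bad = "\<Union>S\<in>Pow (bn_gens D 0). {p. Factorial_Ring.prime p \<and> P p S \<noteq> Q S}"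
  have "rasmussen (prime_field p) D = rasmussen rat_field D"
    if p: "Factorial_Ring.prime p" "p \<notin> ?bad" for p
  proof -
    have "P p (filtered_gens D q 0) = Q (filtered_gens D q 0)" for q
      using p filtered_gens_subset by blast
    moreover have "rasmussen (prime_field p) D
        = (GREATEST q. odd q \<and> \<not> P p (filtered_gens D q 0)) - 1"
      using quotient_ring_coefficients.rasmussen_eq[OF quotient_ring_coefficients_prime_field[OF p(1)]]
      by (simp add: P_def)
    moreover have "rasmussen rat_field D = (GREATEST q. odd q \<and> \<not> Q (filtered_gens D q 0)) - 1"
      using quotient_ring_coefficients.rasmussen_eq[OF quotient_ring_coefficients_rat]
      by (simp add: Q_def)
    ultimately show ?thesis by simp
  qed
  then have "{p. Factorial_Ring.prime p \<and> rasmussen (prime_field p) D \<noteq> rasmussen rat_field D} \<subseteq> ?bad"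
    by blast
  moreover have "finite ?bad"
  proof (intro finite_UN_I)
    show "finite (Pow (bn_gens D 0))" using fin by simp
    show "finite {p. Factorial_Ring.prime p \<and> P p S \<noteq> Q S}" if "S \<in> Pow (bn_gens D 0)" for S
      unfolding P_def Q_def using that bn_gens_subset
      by (intro finite_primes_kernel_in_image finite_generators fin) blast
  qed
  ultimately show ?thesis by (rule finite_subset)
qed

end
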